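(* Let $N\ge2$ and let $a,b$ be real continuous functions with $0<a(x),\,b(y)\le\beta$ for all $x,y\in(-1,1)$ and some constant $\beta$. Let $$\mathbf K_{\rm L}=-\mathbf I_{N-1}\otimes(\mathbf C_a\mathbf D^{(2)})-(\mathbf C_b\mathbf D^{(2)})\otimes\mathbf I_{N-1},\qquad \mathbf K_{\rm B}=-\mathbf B\otimes\mathbf C_a-\mathbf C_b\otimes\mathbf B .$$ Then the preconditioners $\mathbf P_{\rm L}:=\mathbf K_{\rm L}^{-1}$ and $\mathbf P_{\rm B}:=\mathbf K_{\rm B}^{-1}$ admit the explicit representations $$\mathbf P_{\rm L}=-(\mathbf V_b\otimes\mathbf V_a)\,\mathbf\Lambda_{\rm L}\,(\mathbf V_b^{-1}\otimes\mathbf V_a^{-1}),$$ $$\mathbf P_{\rm B}=-(\mathbf C_b^{-1}\otimes\mathbf C_a^{-1})(\mathbf V_b\otimes\mathbf V_a)\,\mathbf\Lambda_{\rm B}\,(\mathbf V_b^{-1}\otimes\mathbf V_a^{-1}),$$ where $$\mathbf\Lambda_{\rm L}=\operatorname{diag}\Big(\frac{\sigma_{a,i}\sigma_{b,j}}{\sigma_{a,i}+\sigma_{b,j}}\Big)_{i,j=1}^{N-1},\qquad \mathbf\Lambda_{\rm B}=\operatorname{diag}\Big(\frac{1}{\sigma_{a,i}+\sigma_{b,j}}\Big)_{i,j=1}^{N-1},$$ and, for $\nu=a,b$, $\mathbf V_\nu=\mathbf C_\nu^{\frac12}\mathbf W^{-\frac12}\mathbf Q_\nu$ and $\mathbf V_\nu^{-1}=\mathbf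 Q_\nu^{\intercal}\mathbf W^{\frac12}\mathbf C_\nu^{-\frac12}$.
   Context: $\mathbb P_N$ is the space of real polynomials of degree at most $N$. The Legendre-Gauss-Lobatto (LGL) nodes $-1=x_0<x_1<\cdots<x_N=1$ are the zeros of $(1-x^2)L_N'(x)$, with positive weights $\omega_j$ such that $\int_{-1}^1\phi\,dx=\sum_{j=0}^N\phi(x_j)\omega_j$ for all $\phi\in\mathbb P_{2N-1}$; the same nodes are used in the $y$ direction, $y_j=x_j$. Let $\ell_j\in\mathbb P_N$ be the Lagrange basis polynomials, $\ell_j(x_i)=\delta_{ij}$, and $\mathbf D^{(2)}=(\ell_j''(x_i))_{1\le i,j\le N-1}$. For $1\le j\le N-1$, $B_j\in\mathbb P_N$ is the unique polynomial with $B_j(\pm1)=0$, $B_j''(x_i)=\delta_{ij}$ ($1\le i\le N-1$), and $\mathbf B=(B_j(x_i))_{1\le i,j\le N-1}=(\mathbf D^{(2)})^{-1}$. Put $\mathbf W=\operatorname{diag}(\omega_1,\ldots,\omega_{N-1})$, $\mathbf C_a=\operatorname{diag}(a(x_1),\ldots,a(x_{N-1}))$, $\mathbf C_b=\operatorname{diag}(b(y_1),\ldots,b(y_{N-1}))$. For $\nu=a,b$ set $\mathbf B_\nu=\mathbf C_\nu^{-1/2}\mathbf B\mathbf C_\nu^{-1/2}$ and $\mathbf S_\nu=\mathbf W^{1/2}\mathbf B_\nu\mathbf W^{-1/2}$; $\mathbf S_\nu$ is symmetric negative definite, and $\mathbf S_\nu=\mathbf Q_\nu\mathbf\Sigma_\nu\mathbf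 Q_\nu^{\intercal}$ is an orthogonal diagonalisation with $\mathbf Q_\nu^{\intercal}\mathbf Q_\nu=\mathbf I_{N-1}$, $\mathbf\Sigma_\nu=\operatorname{diag}(\sigma_{\nu,1},\ldots,\sigma_{\nu,N-1})$, $\sigma_{\nu,k}<0$. Here $\otimes$ is the Kronecker product, and in $\operatorname{diag}(\cdot)_{i,j=1}^{N-1}$ the entry with index $(i,j)$ sits at position $(j-1)(N-1)+i$ ($i$ varies fastest), consistently with $\mathbf V_b\otimes\mathbf V_a$. *)

theory Defs
  imports
    "HOL-Analysis.Analysis"
    "HOL-Computational_Algebra.Polynomial"
    "Jordan_Normal_Form.Gauss_Jordan_Elimination"
begin

text \<open>Rodrigues' formula.\<close>

definition legendre_poly :: "nat \<Rightarrow> real poly" where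
  "legendre_poly n = Polynomial.smult (1 / (2 ^ n * fact n)) ((pderiv ^^ n) ([:-1, 0, 1:] ^ n))"

text \<open>For \<open>N \<ge> 1\<close>, nodes and weights are determined uniquely on \<open>{0..N}\<close>;
  values at indices above \<open>N\<close> are irrelevant.\<close>

definition lgl_rule :: "nat \<Rightarrow> (nat \<Rightarrow> real) \<Rightarrow> (nat \<Rightarrow> real) \<Rightarrow> bool" where
  "lgl_rule N x \<omega> \<longleftrightarrow>
     x 0 = -1 \<and> x N = 1 \<and> strict_mono_on {0..N} x \<and>
     x ` {0..N} = {t. poly ([:1, 0, -1:] * pderiv (legendre_poly N)) t = 0} \<and>
     (\<forall>j\<le>N. 0 < \<omega> j) \<and>
     (\<forall>\<phi> :: real poly. degree \<phi> \<le> 2 * N - 1 \<longrightarrow>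
        integral {-1..1} (poly \<phi>) = (\<Sum>j=0..N. poly \<phi> (x j) * \<omega> j))"

definition lagrange_basis :: "nat \<Rightarrow> (nat \<Rightarrow> real) \<Rightarrow> nat \<Rightarrow> real poly" where
  "lagrange_basis N x j = (THE p. degree p \<le> N \<and>
     (\<forall>i\<le>N. poly p (x i) = (if i = j then 1 else 0)))"

definition birkhoff_basis :: "nat \<Rightarrow> (nat \<Rightarrow> real) \<Rightarrow> nat \<Rightarrow> real poly" where
  "birkhoff_basis N x j = (THE p. degree p \<le> N \<and> poly p (-1) = 0 \<and> poly p 1 = 0 \<and>
     (\<forall>i\<in>{1..N-1}. poly (pderiv (pderiv p)) (x i) = (if i = j then 1 else 0)))"

text \<open>The matrices below are indexed from 1 in the mathematics, but matrix entries are
  counted from 0: position \<open>(i, j)\<close> holds the entry with index \<open>(i + 1, j + 1)\<close>.\<close>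

definition diag1 :: "nat \<Rightarrow> (nat \<Rightarrow> real) \<Rightarrow> real mat" where
  "diag1 n d = mat_diag n (\<lambda>k. d (k + 1))"

text \<open>The entry with index \<open>(i, j)\<close>, \<open>1 \<le> i, j \<le> n\<close>, sits at position
  \<open>(j - 1) * n + i\<close>, counted from 1.\<close>

definition diag2 :: "nat \<Rightarrow> (nat \<Rightarrow> nat \<Rightarrow> real) \<Rightarrow> real mat" where
  "diag2 n d = mat_diag (n * n) (\<lambda>k. d (k mod n + 1) (k div n + 1))"

text \<open>Only used for diagonal matrices with positive diagonal entries.\<close>

definition diag_powr :: "real mat \<Rightarrow> real \<Rightarrow> real mat" where
  "diag_powr A s = mat_diag (dim_row A) (\<lambda>k. (A $$ (k, k)) powr s)"

definition kronecker :: "real mat \<Rightarrow> real mat \<Rightarrow> real mat" (infixl \<open>\<otimes>\<^sub>K\<close> 70) where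
  "A \<otimes>\<^sub>K B = Matrix.mat (dim_row A * dim_row B) (dim_col A * dim_col B)
     (\<lambda>(i, j). A $$ (i div dim_row B, j div dim_col B) * B $$ (i mod dim_row B, j mod dim_col B))"

text \<open>Unspecified when \<open>A\<close> is not invertible.\<close>

definition mat_inv :: "real mat \<Rightarrow> real mat" where
  "mat_inv A = the (mat_inverse A)"

definition D2_mat :: "nat \<Rightarrow> (nat \<Rightarrow> real) \<Rightarrow> real mat" where
  "D2_mat N x = Matrix.mat (N - 1) (N - 1)
     (\<lambda>(i, j). poly (pderiv (pderiv (lagrange_basis N x (j + 1)))) (x (i + 1)))"

definition B_mat :: "nat \<Rightarrow> (nat \<Rightarrow> real) \<Rightarrow> real mat" where
  "B_mat N x = Matrix.mat (N - 1) (N - 1) (\<lambda>(i, j). poly (birkhoff_basis N x (j + 1)) (x (i + 1)))"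

definition W_mat :: "nat \<Rightarrow> (nat \<Rightarrow> real) \<Rightarrow> real mat" where
  "W_mat N \<omega> = diag1 (N - 1) \<omega>"

definition C_mat :: "nat \<Rightarrow> (nat \<Rightarrow> real) \<Rightarrow> (real \<Rightarrow> real) \<Rightarrow> real mat" where
  "C_mat N x c = diag1 (N - 1) (\<lambda>i. c (x i))"

definition Bc_mat :: "nat \<Rightarrow> (nat \<Rightarrow> real) \<Rightarrow> (real \<Rightarrow> real) \<Rightarrow> real mat" where
  "Bc_mat N x c = diag_powr (C_mat N x c) (-1/2) * B_mat N x * diag_powr (C_mat N x c) (-1/2)"

definition S_mat :: "nat \<Rightarrow> (nat \<Rightarrow> real) \<Rightarrow> (nat \<Rightarrow> real) \<Rightarrow> (real \<Rightarrow> real) \<Rightarrow> real mat" where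
  "S_mat N x \<omega> c = diag_powr (W_mat N \<omega>) (1/2) * Bc_mat N x c * diag_powr (W_mat N \<omega>) (-1/2)"

definition orthogonal_diagonalisation ::
  "nat \<Rightarrow> real mat \<Rightarrow> real mat \<Rightarrow> (nat \<Rightarrow> real) \<Rightarrow> bool" where
  "orthogonal_diagonalisation n S Q \<sigma> \<longleftrightarrow>
     Q \<in> carrier_mat n n \<and> transpose_mat Q * Q = 1\<^sub>m n \<and>
     S = Q * diag1 n \<sigma> * transpose_mat Q"

definition V_mat ::
  "nat \<Rightarrow> (nat \<Rightarrow> real) \<Rightarrow> (nat \<Rightarrow> real) \<Rightarrow> (real \<Rightarrow> real) \<Rightarrow> real mat \<Rightarrow> real mat" where
  "V_mat N x \<omega> c Q = diag_powr (C_mat N x c) (1/2) * diag_powr (W_mat N \<omega>) (-1/2) * Q"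

definition KL_mat :: "nat \<Rightarrow> (nat \<Rightarrow> real) \<Rightarrow> (real \<Rightarrow> real) \<Rightarrow> (real \<Rightarrow> real) \<Rightarrow> real mat" where
  "KL_mat N x a b =
     - (1\<^sub>m (N - 1) \<otimes>\<^sub>K (C_mat N x a * D2_mat N x)) - ((C_mat N x b * D2_mat N x) \<otimes>\<^sub>K 1\<^sub>m (N - 1))"

definition KB_mat :: "nat \<Rightarrow> (nat \<Rightarrow> real) \<Rightarrow> (real \<Rightarrow> real) \<Rightarrow> (real \<Rightarrow> real) \<Rightarrow> real mat" where
  "KB_mat N x a b = - (B_mat N x \<otimes>\<^sub>K C_mat N x a) - (C_mat N x b \<otimes>\<^sub>K B_mat N x)"

definition LambdaL :: "nat \<Rightarrow> (nat \<Rightarrow> real) \<Rightarrow> (nat \<Rightarrow> real) \<Rightarrow> real mat" where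
  "LambdaL N \<sigma>a \<sigma>b = diag2 (N - 1) (\<lambda>i j. \<sigma>a i * \<sigma>b j / (\<sigma>a i + \<sigma>b j))"

definition LambdaB :: "nat \<Rightarrow> (nat \<Rightarrow> real) \<Rightarrow> (nat \<Rightarrow> real) \<Rightarrow> real mat" where
  "LambdaB N \<sigma>a \<sigma>b = diag2 (N - 1) (\<lambda>i j. 1 / (\<sigma>a i + \<sigma>b j))"

end

(* From the definition of S_c and its diagonalisation, B = V Sigma V^{-1} C, and since B inverts
   D^{(2)}, also C D^{(2)} = V Sigma^{-1} V^{-1}. Hence K_L and, up to the right factor C_b (x) C_a,
   K_B are conjugated to diagonal matrices by V_b (x) V_a. The sums sigma_{a,i} + sigma_{b,j} do not
   vanish because every sigma is negative: an eigenvector gives a polynomial p of degree at most N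
   with p(-1) = p(1) = 0 and p(x_i) = sigma c(x_i) p''(x_i), and the quadrature rule, exact for
   (p p')', yields sum_j w_j p'(x_j)^2 = - sigma sum_j w_j c(x_j) p''(x_j)^2. *)

theory Submission
  imports Defs "Jordan_Normal_Form.Determinant"
begin

text \<open>Both scalings in \<open>S_mat\<close> are similarities of \<open>B C^{-1}\<close>:
  \<open>B C^{-1} = C^{1/2} W^{-1/2} S W^{1/2} C^{-1/2}\<close>. So
  \<open>V = C^{1/2} W^{-1/2} Q\<close> diagonalises \<open>B C^{-1}\<close>, whose inverse is
  \<open>C D^{(2)}\<close>; this is where the right factor \<open>C\<close> in the formula for
  \<open>B\<close> comes from. A sum of two Kronecker products can be read as one conjugated
  diagonal matrix only if both terms carry the same outer factors. The factor without eigenvalues is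
  therefore padded: \<open>I = V I V^{-1}\<close> in \<open>K_L\<close> and
  \<open>C = V I V^{-1} C\<close> in \<open>K_B\<close>. The second padding makes
  \<open>C_b (x) C_a\<close> a common right factor, so its inverse becomes the leftmost factor of
  \<open>P_B\<close>. The diagonal factor of \<open>-K_L\<close> has entries
  \<open>1/sigma_a + 1/sigma_b\<close>, whose reciprocals are the quotients in
  \<open>Lambda_L\<close>. The polynomial in the sign argument has the entries of
  \<open>z = C^{-1} V e_k\<close> as coefficients in the Birkhoff basis: this vector solves
  \<open>B z = sigma C z\<close>.\<close>

section \<open>Inverses of square matrices\<close>

lemma mat_inv_eqI:
  assumes A: "A \<in> carrier_mat n n" and B: "B \<in> carrier_mat n n" and AB: "A * B = 1\<^sub>m n"
  shows "invertible_mat A" "mat_inv A = B"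
proof -
  have BA: "B * A = 1\<^sub>m n"
    using mat_mult_left_right_inverse[OF A B AB] .
  then show "invertible_mat A"
    using A B AB unfolding invertible_mat_def inverts_mat_def by auto
  \<comment> \<open>Membership in \<open>Units\<close> rules out the outcome \<open>None\<close> of
    Gauss-Jordan elimination, so \<open>mat_inv\<close> is not the unspecified value here.\<close>
  have "A \<in> Units (ring_mat TYPE(real) n ())"
    using A B AB BA unfolding Units_def ring_mat_def by auto
  then obtain C where C: "mat_inverse A = Some C"
    using mat_inverse(1)[OF A, of "()"] by (cases "mat_inverse A") auto
  note C' = mat_inverse(2)[OF A C]
  have "C = (B * A) * C"
    using BA C' left_mult_one_mat[of C n n] by simp
  also have "\<dots> = B * (A * C)"
    using A B C' by (intro assoc_mult_mat) auto
  also have "\<dots> = B"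
    using C' B by simp
  finally show "mat_inv A = B"
    using C unfolding mat_inv_def by simp
qed

text \<open>For square matrices the conclusion fixes every dimension in the premises, so the rule
  applies inside long products without guessing an inner dimension.\<close>

lemma square_mult_carrier [simp]:
  fixes A B :: "'a :: semiring_0 mat"
  shows "A \<in> carrier_mat n n \<Longrightarrow> B \<in> carrier_mat n n \<Longrightarrow> A * B \<in> carrier_mat n n"
  by simp

lemma square_mult_one [simp]:
  fixes A :: "'a :: semiring_1 mat"
  shows "A \<in> carrier_mat n n \<Longrightarrow> A * 1\<^sub>m n = A"
    and "A \<in> carrier_mat n n \<Longrightarrow> 1\<^sub>m n * A = A"
  by simp_all

lemma mat_inv_mat_diag:
  assumes "\<And>i. i < n \<Longrightarrow> d i \<noteq> 0"
  shows "mat_inv (mat_diag n d) = mat_diag n (\<lambda>i. 1 / d i)"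
proof (rule mat_inv_eqI(2))
  show "mat_diag n d * mat_diag n (\<lambda>i. 1 / d i) = 1\<^sub>m n"
    unfolding mat_diag_diag by (rule eq_matI) (auto simp: mat_diag_def assms)
qed auto

section \<open>Kronecker products\<close>

lemma kronecker_carrier [simp]:
  "A \<in> carrier_mat m n \<Longrightarrow> B \<in> carrier_mat p q \<Longrightarrow> A \<otimes>\<^sub>K B \<in> carrier_mat (m * p) (n * q)"
  by (auto simp: kronecker_def)

text \<open>In a Kronecker product whose right factor has size \<open>p\<close>,
  \<open>k div p\<close> numbers the block and \<open>k mod p\<close> the place inside it; the
  bounds say that both are legal indices of their factors.\<close>

lemma div_mod_less_mult:
  fixes k m p :: nat
  assumes "k < m * p"
  shows "k div p < m" "k mod p < p"
proof -
  have "p > 0" using assms by (cases p) auto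
  then show "k div p < m" "k mod p < p"
    using assms by (auto simp: less_mult_imp_div_less)
qed

lemma div_mod_nat_eq_iff:
  fixes k l n :: nat
  shows "k div n = l div n \<and> k mod n = l mod n \<longleftrightarrow> k = l"
  by (metis div_mult_mod_eq)

lemma kronecker_index:
  assumes "A \<in> carrier_mat m n" "B \<in> carrier_mat p q" "i < m * p" "j < n * q"
  shows "(A \<otimes>\<^sub>K B) $$ (i, j) = A $$ (i div p, j div q) * B $$ (i mod p, j mod q)"
  using assms by (auto simp: kronecker_def)

text \<open>Division with remainder by \<open>p\<close> is a bijection from the positions below
  \<open>m * p\<close> onto the pairs, so a summand that splits into a block part and an offset part
  gives a product of sums.\<close>

lemma sum_div_mod_mult:
  fixes f g :: "nat \<Rightarrow> real"
  shows "(\<Sum>k<m * p. f (k div p) * g (k mod p)) = (\<Sum>i<m. f i) * (\<Sum>j<p. g j)"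
proof -
  have "(\<Sum>k<m * p. f (k div p) * g (k mod p)) = (\<Sum>(i, j)\<in>{..<m} \<times> {..<p}. f i * g j)"
  proof (rule sum.reindex_bij_witness[where j = "\<lambda>k. (k div p, k mod p)" and i = "\<lambda>(i, j). i * p + j"])
    fix c assume "c \<in> {..<m} \<times> {..<p}"
    then obtain i j where c: "c = (i, j)" "i < m" "j < p" by auto
    have "i * p + j < (i + 1) * p" using c by simp
    also have "\<dots> \<le> m * p" using c by (intro mult_right_mono) auto
    finally show "(case c of (i, j) \<Rightarrow> i * p + j) \<in> {..<m * p}" using c by simp
  qed (auto simp: div_mod_less_mult)
  then show ?thesis
    by (simp add: sum_product sum.cartesian_product)
qed

text \<open>The mixed-product rule: the inner index \<open>k\<close> splits into
  \<open>k div q\<close> and \<open>k mod q\<close>, the first seen only by \<open>A\<close> and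
  \<open>C\<close>, the second only by \<open>B\<close> and \<open>D\<close>.\<close>

lemma kronecker_mult:
  assumes A: "A \<in> carrier_mat m n" and B: "B \<in> carrier_mat p q"
    and C: "C \<in> carrier_mat n r" and D: "D \<in> carrier_mat q s"
  shows "(A \<otimes>\<^sub>K B) * (C \<otimes>\<^sub>K D) = (A * C) \<otimes>\<^sub>K (B * D)"
proof (rule eq_matI)
  have AB: "A \<otimes>\<^sub>K B \<in> carrier_mat (m * p) (n * q)" and CD: "C \<otimes>\<^sub>K D \<in> carrier_mat (n * q) (r * s)"
    and ACBD: "(A * C) \<otimes>\<^sub>K (B * D) \<in> carrier_mat (m * p) (r * s)"
    and AC: "A * C \<in> carrier_mat m r" and BD: "B * D \<in> carrier_mat p s"
    using assms by auto
  show "dim_row ((A \<otimes>\<^sub>K B) * (C \<otimes>\<^sub>K D)) = dim_row ((A * C) \<otimes>\<^sub>K (B * D))"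
    "dim_col ((A \<otimes>\<^sub>K B) * (C \<otimes>\<^sub>K D)) = dim_col ((A * C) \<otimes>\<^sub>K (B * D))"
    using AB CD ACBD by auto
  fix i j
  assume "i < dim_row ((A * C) \<otimes>\<^sub>K (B * D))" "j < dim_col ((A * C) \<otimes>\<^sub>K (B * D))"
  then have i: "i < m * p" and j: "j < r * s" using ACBD by auto
  note ij = div_mod_less_mult[OF i] div_mod_less_mult[OF j]
  have "((A \<otimes>\<^sub>K B) * (C \<otimes>\<^sub>K D)) $$ (i, j) = (\<Sum>k<n * q. (A \<otimes>\<^sub>K B) $$ (i, k) * (C \<otimes>\<^sub>K D) $$ (k, j))"
    using AB CD i j by (auto simp: scalar_prod_def lessThan_atLeast0)
  also have "\<dots> = (\<Sum>k<n * q. (A $$ (i div p, k div q) * C $$ (k div q, j div s)) *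
      (B $$ (i mod p, k mod q) * D $$ (k mod q, j mod s)))"
    by (rule sum.cong) (auto simp: kronecker_index[OF A B i] kronecker_index[OF C D _ j])
  also have "\<dots> = (\<Sum>k<n. A $$ (i div p, k) * C $$ (k, j div s)) *
      (\<Sum>k<q. B $$ (i mod p, k) * D $$ (k, j mod s))"
    by (rule sum_div_mod_mult)
  also have "\<dots> = (A * C) $$ (i div p, j div s) * (B * D) $$ (i mod p, j mod s)"
    using ij A B C D by (auto simp: scalar_prod_def lessThan_atLeast0)
  also have "\<dots> = ((A * C) \<otimes>\<^sub>K (B * D)) $$ (i, j)"
    using kronecker_index[OF AC BD i j] by simp
  finally show "((A \<otimes>\<^sub>K B) * (C \<otimes>\<^sub>K D)) $$ (i, j) = ((A * C) \<otimes>\<^sub>K (B * D)) $$ (i, j)" .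
qed

text \<open>The left factor is indexed by the block and the right one by the offset. With the
  factors ordered b, a this is exactly the numbering of \<open>diag2\<close>, in which the index
  belonging to a varies fastest.\<close>

lemma kronecker_mat_diag:
  "mat_diag m d \<otimes>\<^sub>K mat_diag n e = mat_diag (m * n) (\<lambda>k. d (k div n) * e (k mod n))"
proof (rule eq_matI)
  fix i j
  assume "i < dim_row (mat_diag (m * n) (\<lambda>k. d (k div n) * e (k mod n)))"
    "j < dim_col (mat_diag (m * n) (\<lambda>k. d (k div n) * e (k mod n)))"
  then have i: "i < m * n" and j: "j < m * n" by (auto simp: mat_diag_def)
  show "(mat_diag m d \<otimes>\<^sub>K mat_diag n e) $$ (i, j) = mat_diag (m * n) (\<lambda>k. d (k div n) * e (k mod n)) $$ (i, j)"
    using kronecker_index[OF mat_diag_dim mat_diag_dim i j] i j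
      div_mod_less_mult[OF i] div_mod_less_mult[OF j] div_mod_nat_eq_iff[of i n j]
    by (auto simp: mat_diag_def)
qed (auto simp: mat_diag_def kronecker_def)

lemma kronecker_one: "1\<^sub>m m \<otimes>\<^sub>K 1\<^sub>m n = 1\<^sub>m (m * n)"
  using kronecker_mat_diag[of m "\<lambda>_. 1" n "\<lambda>_. 1"] by simp

section \<open>Conjugated diagonal matrices\<close>

lemma mat_diag_cong:
  "(\<And>k. k < n \<Longrightarrow> d k = e k) \<Longrightarrow> mat_diag n d = mat_diag n e"
  by (auto simp: mat_diag_def)

lemma mat_diag_minus_add:
  "- mat_diag n d - mat_diag n e = - mat_diag n (\<lambda>k. d k + (e k :: real))"
  by (rule eq_matI) (auto simp: mat_diag_def)

text \<open>\<open>KL_mat\<close> and \<open>KB_mat\<close> both have the shape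
  \<open>- X - Y\<close>; once their terms share outer factors, this pulls the factors out and
  leaves a combination of diagonal matrices.\<close>

lemma minus_diff_mult_distrib_mat:
  fixes L X Y R :: "real mat"
  assumes L: "L \<in> carrier_mat m m" and X: "X \<in> carrier_mat m m" and Y: "Y \<in> carrier_mat m m"
    and R: "R \<in> carrier_mat m m"
  shows "- (L * X * R) - (L * Y * R) = L * (- X - Y) * R"
proof -
  have "L * (- X - Y) * R = L * (- X + - Y) * R"
    using X Y by (simp add: add_uminus_minus_mat)
  also have "\<dots> = L * (- X) * R + L * (- Y) * R"
    using L X Y R by (simp add: mult_add_distrib_mat[of _ m m] add_mult_distrib_mat[of _ m m])
  also have "\<dots> = - (L * X * R) + - (L * Y * R)"
    using L X Y R by auto
  also have "\<dots> = - (L * X * R) - (L * Y * R)"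
    using L X Y R by (subst add_uminus_minus_mat[of _ m m]) auto
  finally show ?thesis ..
qed

text \<open>The product of \<open>K\<close> with the candidate collapses from the inside:
  \<open>R * R'\<close>, then the two diagonals, then \<open>L * L'\<close>, while the two signs
  cancel. Keeping \<open>L\<close> and \<open>R\<close> independent lets one statement serve both
  operators, since for \<open>K_B\<close> the right factor is not the inverse of the left
  one.\<close>

lemma inv_uminus_conjugate_diag:
  fixes L R K U T :: "real mat"
  assumes L: "L \<in> carrier_mat m m" and R: "R \<in> carrier_mat m m" and L': "L' \<in> carrier_mat m m"
    and R': "R' \<in> carrier_mat m m" and LL': "L * L' = 1\<^sub>m m" and RR': "R * R' = 1\<^sub>m m"
    and de: "\<forall>k<m. d k * e k = 1"
    and K: "K = L * (- mat_diag m d) * R"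
  shows "invertible_mat K" "mat_inv K = - (R' * mat_diag m e * L')"
proof -
  let ?D = "mat_diag m d" and ?E = "mat_diag m e"
  have KU: "K = - (L * ?D * R)"
    using K L R carrier_matD[OF mat_diag_dim[of m d]] by auto
  have DE: "?D * ?E = 1\<^sub>m m"
    unfolding mat_diag_diag mat_diag_one[symmetric] by (rule mat_diag_cong) (use de in auto)
  have "K * (- (R' * ?E * L')) = L * ?D * R * (R' * ?E * L')"
    unfolding KU using L R L' R' by simp
  also have "\<dots> = L * (?D * ((R * R') * (?E * L')))"
    using L R L' R' by (simp add: assoc_mult_mat[of _ m m _ m _ m])
  also have "\<dots> = L * ((?D * ?E) * L')"
    using L R L' R' RR' by (simp add: assoc_mult_mat[of _ m m _ m _ m] del: mat_diag_diag)
  also have "\<dots> = 1\<^sub>m m"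
    using L' LL' DE by simp
  finally have "K * (- (R' * ?E * L')) = 1\<^sub>m m" .
  moreover have "K \<in> carrier_mat m m" "- (R' * ?E * L') \<in> carrier_mat m m"
    using L R L' R' KU by simp_all
  ultimately show "invertible_mat K" "mat_inv K = - (R' * mat_diag m e * L')"
    using mat_inv_eqI by blast+
qed

section \<open>Lagrange and Birkhoff interpolation\<close>

lemma pderiv_sum: "pderiv (sum f A) = (\<Sum>i\<in>A. pderiv (f i))"
  using higher_pderiv_sum[of 1 f A] by simp

text \<open>The usual product of normalised linear factors. The index set is arbitrary because two
  are needed: all nodes for the Lagrange basis, and the interior nodes for the second derivatives of
  the Birkhoff basis.\<close>

lemma lagrange_interpolation_exists:
  fixes x :: "'a \<Rightarrow> real"
  assumes I: "finite I" "inj_on x I" "j \<in> I"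
  shows "\<exists>p. degree p < card I \<and> (\<forall>i\<in>I. poly p (x i) = (if i = j then 1 else 0))"
proof -
  define p where "p = (\<Prod>k\<in>I - {j}. Polynomial.smult (1 / (x j - x k)) [:- x k, 1:])"
  have "degree p \<le> sum (degree \<circ> (\<lambda>k. Polynomial.smult (1 / (x j - x k)) [:- x k, 1:])) (I - {j})"
    unfolding p_def using I by (intro degree_prod_sum_le) auto
  also have "\<dots> \<le> (\<Sum>k\<in>I - {j}. 1)"
    by (rule sum_mono) (auto simp: degree_smult_eq)
  also have "\<dots> < card I"
    using I card_gt_0_iff[of I] by auto
  finally have "degree p < card I" .
  moreover have "poly p (x i) = (if i = j then 1 else 0)" if "i \<in> I" for i
  proof (cases "i = j")
    case True
    have "poly p (x j) = (\<Prod>k\<in>I - {j}. 1)"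
      unfolding p_def poly_prod using I
      by (intro prod.cong) (auto simp: inj_on_def diff_divide_distrib[symmetric])
    then show ?thesis using True by simp
  next
    case False
    have "poly p (x i) = 0"
      unfolding p_def poly_prod using I that False by (intro prod_zero) (auto intro!: bexI[of _ i])
    then show ?thesis using False by simp
  qed
  ultimately show ?thesis by blast
qed

lemma poly_eqI_nodes:
  fixes x :: "'a \<Rightarrow> real"
  assumes "inj_on x I" "degree p < card I" "degree q < card I"
    and "\<And>i. i \<in> I \<Longrightarrow> poly p (x i) = poly q (x i)"
  shows "p = q"
  by (rule poly_eqI_degree[where A = "x ` I"]) (use assms in \<open>auto simp: card_image\<close>)

lemma lagrange_basis:
  assumes inj: "inj_on x {0..N}" and j: "j \<le> N"
  shows "degree (lagrange_basis N x j) \<le> N"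
    and "i \<le> N \<Longrightarrow> poly (lagrange_basis N x j) (x i) = (if i = j then 1 else 0)"
proof -
  let ?P = "\<lambda>p. degree p \<le> N \<and> (\<forall>i\<le>N. poly p (x i) = (if i = j then 1 else 0))"
  have "\<exists>p. ?P p"
    using lagrange_interpolation_exists[OF _ inj, of j] j by (auto simp: less_Suc_eq_le)
  moreover have "p = q" if "?P p" "?P q" for p q
    by (rule poly_eqI_nodes[OF inj]) (use that in auto)
  ultimately have "\<exists>!p. ?P p" by blast
  from theI'[OF this] have "?P (lagrange_basis N x j)"
    unfolding lagrange_basis_def .
  then show "degree (lagrange_basis N x j) \<le> N"
    "i \<le> N \<Longrightarrow> poly (lagrange_basis N x j) (x i) = (if i = j then 1 else 0)" by auto
qed

text \<open>Termwise integration with constant term 0. The degree bound is the point: two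
  integrations lead from degree \<open>N - 2\<close> to degree at most \<open>N\<close>.\<close>

lemma antiderivative_poly_exists:
  fixes p :: "real poly"
  shows "\<exists>q. pderiv q = p \<and> degree q \<le> degree p + 1"
proof (intro exI conjI)
  define r where "r = (\<Sum>i\<le>degree p. monom (coeff p i / (real i + 1)) i)"
  have c: "coeff r i = coeff p i / (real i + 1)" for i
  proof (cases "i \<le> degree p")
    case True
    then show ?thesis
      unfolding r_def coeff_sum by (simp add: if_distrib cong: if_cong)
  next
    case False
    then show ?thesis
      unfolding r_def coeff_sum by (auto simp: coeff_eq_0 intro!: sum.neutral)
  qed
  show "pderiv (pCons 0 r) = p"
    by (rule poly_eqI) (simp add: coeff_pderiv c field_simps)
  have "degree r \<le> degree p"
    by (rule degree_le) (auto simp: c coeff_eq_0)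
  then show "degree (pCons 0 r) \<le> degree p + 1"
    by (auto simp: degree_pCons_eq_if)
qed

text \<open>Existence: interpolate the prescribed second derivative at the \<open>N - 1\<close>
  interior nodes, integrate twice, and correct the boundary values. Uniqueness: the second
  derivative of a difference has degree at most \<open>N - 2\<close> and \<open>N - 1\<close> zeros,
  so the difference is affine, and it vanishes at -1 and 1.\<close>

lemma birkhoff_basis:
  assumes N: "N \<ge> 2" and inj: "inj_on x {1..N-1}" and j: "j \<in> {1..N-1}"
  shows "degree (birkhoff_basis N x j) \<le> N"
    and "poly (birkhoff_basis N x j) (-1) = 0" and "poly (birkhoff_basis N x j) 1 = 0"
    and "i \<in> {1..N-1} \<Longrightarrow>
      poly (pderiv (pderiv (birkhoff_basis N x j))) (x i) = (if i = j then 1 else 0)"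
proof -
  let ?P = "\<lambda>p. degree p \<le> N \<and> poly p (-1) = 0 \<and> poly p 1 = 0 \<and>
     (\<forall>i\<in>{1..N-1}. poly (pderiv (pderiv p)) (x i) = (if i = j then 1 else 0))"
  have "\<exists>p. ?P p"
  proof -
    obtain l where l: "degree l < N - 1"
      "\<And>i. i \<in> {1..N-1} \<Longrightarrow> poly l (x i) = (if i = j then 1 else 0)"
      using lagrange_interpolation_exists[OF _ inj j] by auto
    obtain u where u: "pderiv u = l" "degree u \<le> degree l + 1"
      using antiderivative_poly_exists by blast
    obtain q where q: "pderiv q = u" "degree q \<le> degree u + 1"
      using antiderivative_poly_exists by blast
    \<comment> \<open>The subtracted polynomial is the chord of \<open>q\<close> through -1 and 1;
      being affine, it leaves the second derivative unchanged.\<close>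
    define p where "p = q - [:(poly q 1 + poly q (-1)) / 2, (poly q 1 - poly q (-1)) / 2:]"
    have "degree p \<le> N"
      unfolding p_def using l(1) u(2) q(2) N by (intro degree_diff_le) (auto simp: degree_pCons_eq_if)
    moreover have "pderiv (pderiv p) = l"
      unfolding p_def using u q by (simp add: pderiv_diff pderiv_pCons)
    moreover have "poly p (-1) = 0" "poly p 1 = 0"
      unfolding p_def by (simp_all add: field_simps)
    ultimately show ?thesis using l(2) by blast
  qed
  moreover have "p = q" if p: "?P p" and q: "?P q" for p q
  proof -
    have "pderiv (pderiv (p - q)) = 0"
    proof (rule poly_eqI_nodes[OF inj])
      have "degree (p - q) \<le> N" using p q by (intro degree_diff_le) auto
      then show "degree (pderiv (pderiv (p - q))) < card {1..N-1}"
        using N by (simp add: degree_pderiv)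
    qed (use p q N in \<open>auto simp: pderiv_diff\<close>)
    then have "degree (p - q) \<le> 1"
      by (simp add: pderiv_eq_0_iff degree_pderiv)
    then have "p - q = 0"
      by (intro poly_eqI_degree[where A = "{-1, 1}"]) (use p q in auto)
    then show ?thesis by simp
  qed
  ultimately have "\<exists>!p. ?P p" by blast
  from theI'[OF this] have "?P (birkhoff_basis N x j)"
    unfolding birkhoff_basis_def .
  then show "degree (birkhoff_basis N x j) \<le> N"
    "poly (birkhoff_basis N x j) (-1) = 0" "poly (birkhoff_basis N x j) 1 = 0"
    "i \<in> {1..N-1} \<Longrightarrow>
      poly (pderiv (pderiv (birkhoff_basis N x j))) (x i) = (if i = j then 1 else 0)"
    by blast+
qed

lemma lagrange_expansion:
  assumes inj: "inj_on x {0..N}" and p: "degree p \<le> N"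
  shows "p = (\<Sum>k\<le>N. Polynomial.smult (poly p (x k)) (lagrange_basis N x k))"
proof (rule poly_eqI_nodes[OF inj])
  have "degree (\<Sum>k\<le>N. Polynomial.smult (poly p (x k)) (lagrange_basis N x k)) \<le> N"
    by (intro degree_sum_le) (auto intro!: order.trans[OF degree_smult_le] lagrange_basis(1) inj)
  then show "degree (\<Sum>k\<le>N. Polynomial.smult (poly p (x k)) (lagrange_basis N x k)) < card {0..N}"
    by simp
  fix i assume "i \<in> {0..N}"
  then have "(\<Sum>k\<le>N. poly p (x k) * poly (lagrange_basis N x k) (x i)) =
      (\<Sum>k\<le>N. if i = k then poly p (x k) else 0)"
    by (intro sum.cong) (auto simp: lagrange_basis(2)[OF inj])
  then show "poly p (x i) = poly (\<Sum>k\<le>N. Polynomial.smult (poly p (x k)) (lagrange_basis N x k)) (x i)"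
    using \<open>i \<in> {0..N}\<close> by (simp add: poly_sum)
qed (use p in auto)

text \<open>A column of \<open>B_mat\<close> holds the interior values of a Birkhoff polynomial. The
  polynomial vanishes at both ends, so these values already give its full Lagrange expansion, and
  \<open>D2_mat\<close> maps them to its second derivatives at the interior nodes, which are 0 or 1
  by construction.\<close>

lemma D2_mat_mult_B_mat:
  assumes N: "N \<ge> 2" and inj: "inj_on x {0..N}" and x0: "x 0 = -1" and xN: "x N = 1"
  shows "D2_mat N x * B_mat N x = 1\<^sub>m (N - 1)"
proof (rule eq_matI)
  fix i k assume "i < dim_row (1\<^sub>m (N - 1) :: real mat)" "k < dim_col (1\<^sub>m (N - 1) :: real mat)"
  then have i: "i < N - 1" and k: "k < N - 1" by auto
  have inj': "inj_on x {1..N-1}" by (rule inj_on_subset[OF inj]) auto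
  have k': "k + 1 \<in> {1..N-1}" and i': "i + 1 \<in> {1..N-1}" using k i by auto
  define p where "p = birkhoff_basis N x (k + 1)"
  note p = birkhoff_basis[OF N inj' k', folded p_def]
  let ?f = "\<lambda>j. poly p (x j) * poly (pderiv (pderiv (lagrange_basis N x j))) (x (i + 1))"
  have "(D2_mat N x * B_mat N x) $$ (i, k) = (\<Sum>j<N - 1. ?f (Suc j))"
    using i k by (auto simp: D2_mat_def B_mat_def scalar_prod_def lessThan_atLeast0 p_def intro!: sum.cong)
  also have "\<dots> = (\<Sum>j\<in>{1..N-1}. ?f j)"
    by (rule sum.reindex_bij_witness[where i = "\<lambda>j. j - 1" and j = Suc]) auto
  also have "\<dots> = (\<Sum>j\<le>N. ?f j)"
  proof (rule sum.mono_neutral_left)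
    show "\<forall>j\<in>{..N} - {1..N-1}. ?f j = 0"
    proof
      fix j assume "j \<in> {..N} - {1..N-1}"
      then have "j = 0 \<or> j = N" by auto
      then show "?f j = 0" using p x0 xN by auto
    qed
  qed auto
  also have "\<dots> = poly (pderiv (pderiv p)) (x (i + 1))"
    using arg_cong[OF lagrange_expansion[OF inj p(1)], of "\<lambda>q. poly (pderiv (pderiv q)) (x (i + 1))"]
    by (simp add: pderiv_sum pderiv_smult poly_sum)
  also have "\<dots> = 1\<^sub>m (N - 1) $$ (i, k)"
    using p(4)[OF i'] i k by auto
  finally show "(D2_mat N x * B_mat N x) $$ (i, k) = 1\<^sub>m (N - 1) $$ (i, k)" .
qed (auto simp: D2_mat_def B_mat_def)

section \<open>The quadrature rule and the sign of the eigenvalues\<close>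

lemma lgl_rule_nodes:
  assumes N: "N \<ge> 2" and "lgl_rule N x \<omega>"
  shows "inj_on x {0..N}" "i \<in> {1..N-1} \<Longrightarrow> x i \<in> {-1<..<1}" "i \<in> {1..N-1} \<Longrightarrow> 0 < \<omega> i"
proof -
  have sm: "strict_mono_on {0..N} x" and x: "x 0 = -1" "x N = 1" "\<forall>j\<le>N. 0 < \<omega> j"
    using assms(2) unfolding lgl_rule_def by auto
  show "inj_on x {0..N}" using sm by (rule strict_mono_on_imp_inj_on)
  assume i: "i \<in> {1..N-1}"
  then have "x 0 < x i" "x i < x N"
    using N by (auto intro!: strict_mono_onD[OF sm])
  then show "x i \<in> {-1<..<1}" using x by auto
  show "0 < \<omega> i" using x(3) i by auto
qed

lemma lgl_eigenvalue_neg: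
  fixes p :: "real poly"
  assumes N: "N \<ge> 2" and rule: "lgl_rule N x \<omega>"
    and p: "degree p \<le> N" "poly p (-1) = 0" "poly p 1 = 0" "p \<noteq> 0"
    and c: "\<And>i. i \<in> {1..N-1} \<Longrightarrow> 0 < c i"
    and eig: "\<And>i. i \<in> {1..N-1} \<Longrightarrow> poly p (x i) = s * c i * poly (pderiv (pderiv p)) (x i)"
  shows "s < 0"
proof -
  let ?p' = "pderiv p" and ?p'' = "pderiv (pderiv p)"
  have x: "x 0 = -1" "x N = 1" and w: "\<And>j. j \<le> N \<Longrightarrow> 0 < \<omega> j"
    and quad: "\<And>\<phi>. degree \<phi> \<le> 2 * N - 1 \<Longrightarrow>
        integral {-1..1} (poly \<phi>) = (\<Sum>j=0..N. poly \<phi> (x j) * \<omega> j)"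
    using rule unfolding lgl_rule_def by auto
  note inj = lgl_rule_nodes(1)[OF N rule]
  \<comment> \<open>The derivative of \<open>p * ?p'\<close> has degree at most
    \<open>2 * N - 2\<close>, which lies within the exactness of the rule.\<close>
  have d: "degree (pderiv (p * ?p')) \<le> 2 * N - 1"
    using degree_mult_le[of p ?p'] p(1) by (simp add: degree_pderiv)
  have "(poly (pderiv (p * ?p')) has_integral (poly (p * ?p') 1 - poly (p * ?p') (-1))) {-1..1}"
  proof (rule fundamental_theorem_of_calculus)
    fix t :: real
    show "(poly (p * ?p') has_vector_derivative poly (pderiv (p * ?p')) t) (at t within {-1..1})"
      unfolding has_real_derivative_iff_has_vector_derivative[symmetric]
      by (rule has_field_derivative_at_within[OF poly_DERIV])
  qed simp
  then have "(poly (pderiv (p * ?p')) has_integral 0) {-1..1}"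
    using p by simp
  then have "0 = (\<Sum>j=0..N. poly (pderiv (p * ?p')) (x j) * \<omega> j)"
    using quad[OF d] by (simp add: integral_unique)
  also have "\<dots> = (\<Sum>j=0..N. \<omega> j * (poly ?p' (x j))\<^sup>2) + (\<Sum>j=0..N. \<omega> j * poly p (x j) * poly ?p'' (x j))"
    by (simp add: pderiv_mult sum.distrib[symmetric] algebra_simps power2_eq_square)
  \<comment> \<open>The end nodes must drop out because \<open>eig\<close> is available at interior
    nodes only; they do since \<open>p\<close> vanishes there.\<close>
  also have "(\<Sum>j=0..N. \<omega> j * poly p (x j) * poly ?p'' (x j)) =
      (\<Sum>j=1..N-1. \<omega> j * poly p (x j) * poly ?p'' (x j))"
  proof (rule sum.mono_neutral_right)
    show "\<forall>j\<in>{0..N} - {1..N-1}. \<omega> j * poly p (x j) * poly ?p'' (x j) = 0"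
    proof
      fix j assume "j \<in> {0..N} - {1..N-1}"
      then have "j = 0 \<or> j = N" by auto
      then show "\<omega> j * poly p (x j) * poly ?p'' (x j) = 0" using p x by auto
    qed
  qed auto
  also have "\<dots> = s * (\<Sum>j=1..N-1. \<omega> j * c j * (poly ?p'' (x j))\<^sup>2)"
    unfolding sum_distrib_left by (rule sum.cong) (auto simp: eig power2_eq_square)
  finally have eq: "(\<Sum>j=0..N. \<omega> j * (poly ?p' (x j))\<^sup>2) =
      - s * (\<Sum>j=1..N-1. \<omega> j * c j * (poly ?p'' (x j))\<^sup>2)" by simp
  have "?p' \<noteq> 0"
  proof
    assume "?p' = 0"
    then obtain t where "p = [:t:]" by (metis pderiv_eq_0_iff degree_eq_zeroE)
    then show False using p by auto
  qed
  \<comment> \<open>Strictness comes from here: a nonzero \<open>?p'\<close> has degree at most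
    \<open>N - 1\<close> and cannot vanish at all \<open>N + 1\<close> nodes.\<close>
  have "\<exists>j\<in>{0..N}. poly ?p' (x j) \<noteq> 0"
  proof (rule ccontr)
    assume "\<not> (\<exists>j\<in>{0..N}. poly ?p' (x j) \<noteq> 0)"
    then have "?p' = 0"
      by (intro poly_eqI_nodes[OF inj]) (use p in \<open>auto simp: degree_pderiv\<close>)
    with \<open>?p' \<noteq> 0\<close> show False ..
  qed
  then obtain j where j: "j \<in> {0..N}" "poly ?p' (x j) \<noteq> 0" ..
  have "0 < (\<Sum>j=0..N. \<omega> j * (poly ?p' (x j))\<^sup>2)"
    by (rule sum_pos2[OF _ j(1)]) (use j w in \<open>auto simp: less_imp_le\<close>)
  \<comment> \<open>Nonnegativity is enough on this side: if \<open>- s\<close> times a nonnegative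
    number is positive, then \<open>s\<close> is negative.\<close>
  moreover have "0 \<le> (\<Sum>j=1..N-1. \<omega> j * c j * (poly ?p'' (x j))\<^sup>2)"
    using w c by (intro sum_nonneg mult_nonneg_nonneg) (auto simp: less_imp_le)
  ultimately show "s < 0"
    unfolding eq zero_less_mult_iff by linarith
qed

text \<open>Reading \<open>z\<close> as coefficients in the Birkhoff basis gives a polynomial with
  interior second derivatives \<open>z\<close> and interior values \<open>B z\<close>. The
  generalised eigenvalue equation \<open>B z = s C z\<close> then becomes the pointwise relation
  between \<open>p\<close> and its second derivative, and \<open>z i0\<close> witnesses that
  \<open>p\<close> is nonzero.\<close>

lemma B_mat_eigenvalue_neg:
  assumes N: "N \<ge> 2" and rule: "lgl_rule N x \<omega>"
    and c: "\<And>i. i < N - 1 \<Longrightarrow> 0 < c (i + 1)"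
    and z: "i0 < N - 1" "z i0 \<noteq> 0"
    and eig: "\<And>i. i < N - 1 \<Longrightarrow> (\<Sum>j<N-1. B_mat N x $$ (i, j) * z j) = s * c (i + 1) * z i"
  shows "s < 0"
proof -
  have inj': "inj_on x {1..N-1}"
    by (rule inj_on_subset[OF lgl_rule_nodes(1)[OF N rule]]) auto
  note bk = birkhoff_basis[OF N inj']
  define p where "p = (\<Sum>j<N-1. Polynomial.smult (z j) (birkhoff_basis N x (j + 1)))"
  have p2: "poly (pderiv (pderiv p)) (x (i + 1)) = z i" if i: "i < N - 1" for i
  proof -
    have "poly (pderiv (pderiv p)) (x (i + 1)) =
        (\<Sum>j<N-1. z j * poly (pderiv (pderiv (birkhoff_basis N x (j + 1)))) (x (i + 1)))"
      unfolding p_def by (simp add: pderiv_sum pderiv_smult poly_sum)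
    also have "\<dots> = (\<Sum>j<N-1. if i = j then z j else 0)"
    proof (rule sum.cong)
      fix j assume "j \<in> {..<N - 1}"
      then show "z j * poly (pderiv (pderiv (birkhoff_basis N x (j + 1)))) (x (i + 1)) =
          (if i = j then z j else 0)"
        using i bk(4)[of "j + 1" "i + 1"] by auto
    qed simp
    finally show ?thesis using i by simp
  qed
  have p0: "poly p (x (i + 1)) = s * c (i + 1) * z i" if i: "i < N - 1" for i
    using eig[OF i, symmetric] i unfolding p_def by (simp add: poly_sum B_mat_def mult.commute)
  show ?thesis
  proof (rule lgl_eigenvalue_neg[OF N rule, where p = p and c = c])
    show "degree p \<le> N"
      unfolding p_def
      by (intro degree_sum_le) (auto intro!: order.trans[OF degree_smult_le] bk(1))
    show "poly p (-1) = 0" "poly p 1 = 0"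
      unfolding p_def poly_sum by (auto intro!: sum.neutral bk(2,3))
    show "p \<noteq> 0" using p2[OF z(1)] z(2) by auto
    fix i assume i: "i \<in> {1..N-1}"
    then have i': "i - 1 < N - 1" "i - 1 + 1 = i" by auto
    show "0 < c i" using c[OF i'(1)] unfolding i'(2) .
    show "poly p (x i) = s * c i * poly (pderiv (pderiv p)) (x i)"
      using p0[OF i'(1)] p2[OF i'(1)] unfolding i'(2) by simp
  qed
qed

section \<open>Diagonalisation by \<open>V\<close>\<close>

lemma V_mat_inverse:
  fixes c :: "real \<Rightarrow> real"
  assumes N: "N \<ge> 2" and rule: "lgl_rule N x \<omega>" and c: "\<forall>t\<in>{-1<..<1}. 0 < c t"
    and Q: "Q \<in> carrier_mat (N - 1) (N - 1)" "transpose_mat Q * Q = 1\<^sub>m (N - 1)"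
  shows "V_mat N x \<omega> c Q \<in> carrier_mat (N - 1) (N - 1)"
    and "V_mat N x \<omega> c Q *
      (transpose_mat Q * diag_powr (W_mat N \<omega>) (1/2) * diag_powr (C_mat N x c) (-1/2)) = 1\<^sub>m (N - 1)"
proof -
  note [simp del] = One_nat_def
  let ?n = "N - 1"
  define ch where "ch s = mat_diag ?n (\<lambda>k. c (x (k + 1)) powr s)" for s
  define wh where "wh s = mat_diag ?n (\<lambda>k. \<omega> (k + 1) powr s)" for s
  have C: "diag_powr (C_mat N x c) s = ch s" for s
    by (auto simp: diag_powr_def C_mat_def diag1_def mat_diag_def ch_def)
  have W: "diag_powr (W_mat N \<omega>) s = wh s" for s
    by (auto simp: diag_powr_def W_mat_def diag1_def mat_diag_def wh_def)
  have car [simp]: "ch s \<in> carrier_mat ?n ?n" "wh s \<in> carrier_mat ?n ?n" for s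
    by (auto simp: ch_def wh_def)
  \<comment> \<open>\<open>powr\<close> with base 0 is 0 even for exponent 0, so opposite powers
    cancel only because weights and coefficient values are nonzero.\<close>
  have cw: "0 < c (x (k + 1))" "0 < \<omega> (k + 1)" "c (x (k + 1)) \<noteq> 0" "\<omega> (k + 1) \<noteq> 0" if "k < ?n" for k
    using that c lgl_rule_nodes(2,3)[OF N rule, of "k + 1"] by force+
  have ww: "wh (-1/2) * wh (1/2) = 1\<^sub>m ?n"
    unfolding wh_def mat_diag_diag mat_diag_one[symmetric]
    by (rule mat_diag_cong) (use cw in \<open>simp add: powr_add[symmetric]\<close>)
  have cc: "ch (1/2) * ch (-1/2) = 1\<^sub>m ?n"
    unfolding ch_def mat_diag_diag mat_diag_one[symmetric]
    by (rule mat_diag_cong) (use cw in \<open>simp add: powr_add[symmetric]\<close>)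
  \<comment> \<open>Squareness reverses the orthogonality relation; in the product below,
    \<open>Q\<close> stands to the left of its transpose.\<close>
  have Q': "transpose_mat Q \<in> carrier_mat ?n ?n" "Q * transpose_mat Q = 1\<^sub>m ?n"
    using Q mat_mult_left_right_inverse[of "transpose_mat Q" ?n Q] by auto
  show "V_mat N x \<omega> c Q \<in> carrier_mat ?n ?n"
    unfolding V_mat_def C W using Q by simp
  have "V_mat N x \<omega> c Q *
      (transpose_mat Q * diag_powr (W_mat N \<omega>) (1/2) * diag_powr (C_mat N x c) (-1/2)) =
      ch (1/2) * (wh (-1/2) * ((Q * transpose_mat Q) * (wh (1/2) * ch (-1/2))))"
    unfolding V_mat_def C W using Q(1) Q'(1) by (simp add: assoc_mult_mat[of _ ?n ?n _ ?n _ ?n])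
  also have "\<dots> = ch (1/2) * ((wh (-1/2) * wh (1/2)) * ch (-1/2))"
    unfolding Q'(2) by (simp add: assoc_mult_mat[of _ ?n ?n _ ?n _ ?n])
  also have "\<dots> = 1\<^sub>m ?n"
    unfolding ww using cc by simp
  finally show "V_mat N x \<omega> c Q *
      (transpose_mat Q * diag_powr (W_mat N \<omega>) (1/2) * diag_powr (C_mat N x c) (-1/2)) = 1\<^sub>m ?n" .
qed

text \<open>The right-hand side contains \<open>Q\<close>, the eigenvalues and the transpose of
  \<open>Q\<close> in a row, that is \<open>S_mat\<close>; unfolding it leaves \<open>B_mat\<close>
  between diagonal matrices that cancel.\<close>

lemma B_mat_diagonalisation:
  fixes c :: "real \<Rightarrow> real"
  assumes N: "N \<ge> 2" and rule: "lgl_rule N x \<omega>" and c: "\<forall>t\<in>{-1<..<1}. 0 < c t"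
    and od: "orthogonal_diagonalisation (N - 1) (S_mat N x \<omega> c) Q \<sigma>"
  shows "B_mat N x = V_mat N x \<omega> c Q * diag1 (N - 1) \<sigma> * mat_inv (V_mat N x \<omega> c Q) * C_mat N x c"
proof -
  note [simp del] = One_nat_def
  let ?n = "N - 1"
  define ch where "ch s = mat_diag ?n (\<lambda>k. c (x (k + 1)) powr s)" for s
  define wh where "wh s = mat_diag ?n (\<lambda>k. \<omega> (k + 1) powr s)" for s
  have C: "diag_powr (C_mat N x c) s = ch s" for s
    by (auto simp: diag_powr_def C_mat_def diag1_def mat_diag_def ch_def)
  have W: "diag_powr (W_mat N \<omega>) s = wh s" for s
    by (auto simp: diag_powr_def W_mat_def diag1_def mat_diag_def wh_def)
  have car [simp]: "ch s \<in> carrier_mat ?n ?n" "wh s \<in> carrier_mat ?n ?n"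
    "diag1 ?n \<sigma> \<in> carrier_mat ?n ?n" "B_mat N x \<in> carrier_mat ?n ?n" for s
    by (auto simp: ch_def wh_def diag1_def B_mat_def)
  have cw: "0 < c (x (k + 1))" "0 < \<omega> (k + 1)" "c (x (k + 1)) \<noteq> 0" "\<omega> (k + 1) \<noteq> 0" if "k < ?n" for k
    using that c lgl_rule_nodes(2,3)[OF N rule, of "k + 1"] by force+
  have Q: "Q \<in> carrier_mat ?n ?n" "transpose_mat Q \<in> carrier_mat ?n ?n" "transpose_mat Q * Q = 1\<^sub>m ?n"
    and S: "S_mat N x \<omega> c = Q * diag1 ?n \<sigma> * transpose_mat Q"
    using od unfolding orthogonal_diagonalisation_def by auto
  note V = V_mat_inverse[OF N rule c Q(1,3)]
  have Vi: "mat_inv (V_mat N x \<omega> c Q) = transpose_mat Q * wh (1/2) * ch (-1/2)"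
    using mat_inv_eqI(2)[OF V(1) _ V(2)] Q unfolding C W by simp
  \<comment> \<open>The final factor \<open>C\<close> raises the exponent from -1/2 to 1/2, which is
    what cancels the scaling to the right of \<open>B\<close> in \<open>Bc_mat\<close>.\<close>
  have cC: "ch (-1/2) * C_mat N x c = ch (1/2)"
    unfolding ch_def C_mat_def diag1_def mat_diag_diag
  proof (rule mat_diag_cong)
    fix k assume k: "k < ?n"
    show "c (x (k + 1)) powr (-1/2) * c (x (k + 1)) = c (x (k + 1)) powr (1/2)"
      using powr_add[of "c (x (k + 1))" "-1/2" 1] cw(1)[OF k] by simp
  qed
  have "V_mat N x \<omega> c Q * diag1 ?n \<sigma> * mat_inv (V_mat N x \<omega> c Q) * C_mat N x c =
      ch (1/2) * (wh (-1/2) * (Q * diag1 ?n \<sigma> * transpose_mat Q * (wh (1/2) * (ch (-1/2) * C_mat N x c))))"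
    unfolding Vi unfolding V_mat_def C W using Q
    by (simp add: assoc_mult_mat[of _ ?n ?n _ ?n _ ?n] C_mat_def diag1_def)
  \<comment> \<open>On each side of \<open>B_mat\<close> stand four diagonal matrices, and the
    exponents of \<open>c\<close> and of \<open>\<omega>\<close> both add up to zero.\<close>
  also have "\<dots> = (ch (1/2) * wh (-1/2) * wh (1/2) * ch (-1/2)) * B_mat N x *
      (ch (-1/2) * wh (-1/2) * wh (1/2) * ch (1/2))"
    unfolding cC S[symmetric] S_mat_def Bc_mat_def C W
    by (simp add: assoc_mult_mat[of _ ?n ?n _ ?n _ ?n])
  also have "ch (1/2) * wh (-1/2) * wh (1/2) * ch (-1/2) = 1\<^sub>m ?n"
    unfolding wh_def ch_def mat_diag_diag mat_diag_one[symmetric]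
    by (rule mat_diag_cong) (use cw in \<open>simp add: powr_minus field_simps\<close>)
  also have "ch (-1/2) * wh (-1/2) * wh (1/2) * ch (1/2) = 1\<^sub>m ?n"
    unfolding wh_def ch_def mat_diag_diag mat_diag_one[symmetric]
    by (rule mat_diag_cong) (use cw in \<open>simp add: powr_minus field_simps\<close>)
  finally show ?thesis by simp
qed

text \<open>Multiplying \<open>B = V Sigma V^{-1} C\<close> by \<open>C^{-1} V\<close> gives
  \<open>B (C^{-1} V) = V Sigma\<close>. Its column \<open>k\<close> says that
  \<open>z = C^{-1} V e_k\<close> solves \<open>B z = sigma C z\<close>, the equation whose sign is
  already known.\<close>

lemma S_mat_eigenvalue_neg:
  fixes c :: "real \<Rightarrow> real"
  assumes N: "N \<ge> 2" and rule: "lgl_rule N x \<omega>" and c: "\<forall>t\<in>{-1<..<1}. 0 < c t"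
    and od: "orthogonal_diagonalisation (N - 1) (S_mat N x \<omega> c) Q \<sigma>"
    and k: "k < N - 1"
  shows "\<sigma> (k + 1) < 0"
proof -
  note [simp del] = One_nat_def
  let ?n = "N - 1"
  define V where "V = V_mat N x \<omega> c Q"
  define V' where "V' = mat_inv V"
  have Q: "Q \<in> carrier_mat ?n ?n" "transpose_mat Q * Q = 1\<^sub>m ?n"
    using od unfolding orthogonal_diagonalisation_def by auto
  note V = V_mat_inverse[OF N rule c Q, folded V_def]
  let ?U = "transpose_mat Q * diag_powr (W_mat N \<omega>) (1/2) * diag_powr (C_mat N x c) (-1/2)"
  have U: "?U \<in> carrier_mat ?n ?n"
    using Q by (auto simp: diag_powr_def C_mat_def W_mat_def diag1_def mat_diag_def)
  have V'U: "V' = ?U" unfolding V'_def by (rule mat_inv_eqI(2)[OF V(1) U V(2)])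
  have V': "V' \<in> carrier_mat ?n ?n" "V' * V = 1\<^sub>m ?n"
    unfolding V'U using U mat_mult_left_right_inverse[OF V(1) U V(2)] by auto
  have B: "B_mat N x = V * diag1 ?n \<sigma> * V' * C_mat N x c"
    unfolding V_def V'_def by (rule B_mat_diagonalisation[OF N rule c od])
  have cp: "0 < c (x (k + 1))" if "k < ?n" for k
    using that c lgl_rule_nodes(2)[OF N rule, of "k + 1"] by auto
  define z where "z j = V $$ (j, k) / c (x (j + 1))" for j
  let ?D = "mat_diag ?n (\<lambda>j. 1 / c (x (j + 1)))"
  have CD: "C_mat N x c * ?D = 1\<^sub>m ?n"
    unfolding C_mat_def diag1_def mat_diag_diag mat_diag_one[symmetric]
    by (rule mat_diag_cong) (use cp in \<open>auto simp: less_imp_neq[symmetric]\<close>)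
  have "B_mat N x * (?D * V) = V * (diag1 ?n \<sigma> * (V' * ((C_mat N x c * ?D) * V)))"
    unfolding B using V(1) V'(1)
    by (simp add: assoc_mult_mat[of _ ?n ?n _ ?n _ ?n] C_mat_def diag1_def del: mat_diag_diag)
  also have "\<dots> = V * diag1 ?n \<sigma>"
    unfolding CD using V(1) V' by (simp add: diag1_def)
  finally have BDV: "B_mat N x * (?D * V) = V * diag1 ?n \<sigma>" .
  \<comment> \<open>A zero column of \<open>V\<close> would produce a zero on the diagonal of
    \<open>V' * V\<close>.\<close>
  have "\<exists>i<?n. V $$ (i, k) \<noteq> 0"
  proof (rule ccontr)
    assume "\<not> (\<exists>i<?n. V $$ (i, k) \<noteq> 0)"
    then have "(V' * V) $$ (k, k) = 0"
      using V(1) V'(1) k by (auto simp: scalar_prod_def intro!: sum.neutral)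
    then show False using V'(2) k by simp
  qed
  then obtain i0 where i0: "i0 < ?n" "V $$ (i0, k) \<noteq> 0" by blast
  show ?thesis
  proof (rule B_mat_eigenvalue_neg[OF N rule, where c = "\<lambda>i. c (x i)" and z = z])
    show "i0 < ?n" "z i0 \<noteq> 0" using i0 cp[OF i0(1)] by (auto simp: z_def)
    fix i assume i: "i < ?n"
    show "0 < c (x (i + 1))" using cp[OF i] .
    have "(\<Sum>j<?n. B_mat N x $$ (i, j) * z j) = (B_mat N x * (?D * V)) $$ (i, k)"
      using i k V(1)
      by (auto simp: mat_diag_mult_left[OF V(1)] scalar_prod_def B_mat_def lessThan_atLeast0 z_def intro!: sum.cong)
    also have "\<dots> = \<sigma> (k + 1) * V $$ (i, k)"
      unfolding BDV diag1_def using i k by (simp add: mat_diag_mult_right[OF V(1)])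
    also have "\<dots> = \<sigma> (k + 1) * c (x (i + 1)) * z i"
      using cp[OF i] by (simp add: z_def)
    finally show "(\<Sum>j<?n. B_mat N x $$ (i, j) * z j) = \<sigma> (k + 1) * c (x (i + 1)) * z i" .
  qed
qed

text \<open>\<open>C D^{(2)}\<close> is the inverse of \<open>B C^{-1} = V Sigma V^{-1}\<close>, so
  the same \<open>V\<close> diagonalises it with reciprocal eigenvalues.\<close>

lemma C_mat_mult_D2_mat:
  fixes c :: "real \<Rightarrow> real"
  assumes N: "N \<ge> 2" and rule: "lgl_rule N x \<omega>" and c: "\<forall>t\<in>{-1<..<1}. 0 < c t"
    and od: "orthogonal_diagonalisation (N - 1) (S_mat N x \<omega> c) Q \<sigma>"
  shows "C_mat N x c * D2_mat N x =
    V_mat N x \<omega> c Q * diag1 (N - 1) (\<lambda>k. 1 / \<sigma> k) * mat_inv (V_mat N x \<omega> c Q)"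
proof -
  note [simp del] = One_nat_def
  let ?n = "N - 1"
  note B = B_mat_diagonalisation[OF assms]
  have Q: "Q \<in> carrier_mat ?n ?n" "transpose_mat Q * Q = 1\<^sub>m ?n"
    using od unfolding orthogonal_diagonalisation_def by auto
  note V = V_mat_inverse[OF N rule c Q]
  define V0 where "V0 = V_mat N x \<omega> c Q"
  define V1 where "V1 = mat_inv V0"
  let ?U = "transpose_mat Q * diag_powr (W_mat N \<omega>) (1/2) * diag_powr (C_mat N x c) (-1/2)"
  have U: "?U \<in> carrier_mat ?n ?n"
    using Q by (auto simp: diag_powr_def C_mat_def W_mat_def diag1_def mat_diag_def)
  have V1: "V1 = ?U" unfolding V1_def V0_def by (rule mat_inv_eqI(2)[OF V(1) U V(2)])
  have car: "V0 \<in> carrier_mat ?n ?n" "V1 \<in> carrier_mat ?n ?n" "C_mat N x c \<in> carrier_mat ?n ?n"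
    "diag1 ?n \<sigma> \<in> carrier_mat ?n ?n" "diag1 ?n (\<lambda>k. 1 / \<sigma> k) \<in> carrier_mat ?n ?n"
    "D2_mat N x \<in> carrier_mat ?n ?n"
    using V(1) U unfolding V1 V0_def by (auto simp: C_mat_def diag1_def D2_mat_def)
  have VV: "V0 * V1 = 1\<^sub>m ?n" "V1 * V0 = 1\<^sub>m ?n"
    using V(2) mat_mult_left_right_inverse[OF V(1) U V(2)] unfolding V1 V0_def by auto
  \<comment> \<open>The reciprocals are genuine because every eigenvalue is negative.\<close>
  have ss: "diag1 ?n (\<lambda>k. 1 / \<sigma> k) * diag1 ?n \<sigma> = 1\<^sub>m ?n"
    unfolding diag1_def mat_diag_diag mat_diag_one[symmetric]
    by (rule mat_diag_cong) (use S_mat_eigenvalue_neg[OF assms] in fastforce)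
  have "D2_mat N x * (V0 * diag1 ?n \<sigma> * V1 * C_mat N x c) = 1\<^sub>m ?n"
    using D2_mat_mult_B_mat[OF N lgl_rule_nodes(1)[OF N rule]] rule
    unfolding B V0_def V1_def lgl_rule_def by auto
  \<comment> \<open>Swapping the two mutually inverse factors brings \<open>C\<close> and
    \<open>D^{(2)}\<close> next to each other.\<close>
  then have "V0 * diag1 ?n \<sigma> * V1 * C_mat N x c * D2_mat N x = 1\<^sub>m ?n"
    using car by (intro mat_mult_left_right_inverse[of "D2_mat N x"]) auto
  then have *: "V0 * (diag1 ?n \<sigma> * (V1 * (C_mat N x c * D2_mat N x))) = 1\<^sub>m ?n"
    using car by (simp add: assoc_mult_mat[of _ ?n ?n _ ?n _ ?n])
  have "V0 * diag1 ?n (\<lambda>k. 1 / \<sigma> k) * V1 =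
      V0 * diag1 ?n (\<lambda>k. 1 / \<sigma> k) * V1 * (V0 * (diag1 ?n \<sigma> * (V1 * (C_mat N x c * D2_mat N x))))"
    unfolding * using car by simp
  also have "\<dots> = V0 * (diag1 ?n (\<lambda>k. 1 / \<sigma> k) * ((V1 * V0) * (diag1 ?n \<sigma> * (V1 * (C_mat N x c * D2_mat N x)))))"
    using car by (simp add: assoc_mult_mat[of _ ?n ?n _ ?n _ ?n])
  also have "\<dots> = V0 * ((diag1 ?n (\<lambda>k. 1 / \<sigma> k) * diag1 ?n \<sigma>) * (V1 * (C_mat N x c * D2_mat N x)))"
    unfolding VV using car by (simp add: assoc_mult_mat[of _ ?n ?n _ ?n _ ?n])
  also have "\<dots> = (V0 * V1) * (C_mat N x c * D2_mat N x)"
    unfolding ss using car by (simp add: assoc_mult_mat[of _ ?n ?n _ ?n _ ?n])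
  also have "\<dots> = C_mat N x c * D2_mat N x"
    unfolding VV using car by simp
  finally show ?thesis unfolding V0_def V1_def ..
qed

section \<open>The two-dimensional operators and their inverses\<close>

lemma kronecker_mult3:
  assumes "A \<in> carrier_mat n n" "B \<in> carrier_mat n n" "C \<in> carrier_mat n n"
    and "A' \<in> carrier_mat n n" "B' \<in> carrier_mat n n" "C' \<in> carrier_mat n n"
  shows "(A * B * C) \<otimes>\<^sub>K (A' * B' * C') = (A \<otimes>\<^sub>K A') * (B \<otimes>\<^sub>K B') * (C \<otimes>\<^sub>K C')"
  using assms by (simp add: kronecker_mult[of _ n n _ n n _ n _ n])

lemma C_mat_inverse:
  assumes "\<And>k. k < N - 1 \<Longrightarrow> c (x (k + 1)) \<noteq> 0"
  shows "C_mat N x c \<in> carrier_mat (N - 1) (N - 1)"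
    and "mat_inv (C_mat N x c) \<in> carrier_mat (N - 1) (N - 1)"
    and "C_mat N x c * mat_inv (C_mat N x c) = 1\<^sub>m (N - 1)"
proof -
  let ?d = "\<lambda>k. c (x (k + 1))"
  have inv: "mat_inv (C_mat N x c) = mat_diag (N - 1) (\<lambda>k. 1 / ?d k)"
    unfolding C_mat_def diag1_def by (rule mat_inv_mat_diag) (rule assms)
  show "C_mat N x c \<in> carrier_mat (N - 1) (N - 1)"
    "mat_inv (C_mat N x c) \<in> carrier_mat (N - 1) (N - 1)"
    unfolding inv unfolding C_mat_def diag1_def by (rule mat_diag_dim)+
  show "C_mat N x c * mat_inv (C_mat N x c) = 1\<^sub>m (N - 1)"
    unfolding inv unfolding C_mat_def diag1_def mat_diag_diag mat_diag_one[symmetric]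
    by (rule mat_diag_cong) (use assms in simp)
qed


theorem theorem3p1:
  fixes N :: nat and a b :: "real \<Rightarrow> real" and \<beta> :: real
    and x \<omega> \<sigma>a \<sigma>b :: "nat \<Rightarrow> real" and Qa Qb :: "real mat"
  assumes "N \<ge> 2"
    and "lgl_rule N x \<omega>"
    and "continuous_on {-1<..<1} a" and "continuous_on {-1<..<1} b"
    and "\<forall>t\<in>{-1<..<1}. 0 < a t \<and> a t \<le> \<beta>"
    and "\<forall>t\<in>{-1<..<1}. 0 < b t \<and> b t \<le> \<beta>"
    and "orthogonal_diagonalisation (N - 1) (S_mat N x \<omega> a) Qa \<sigma>a"
    and "orthogonal_diagonalisation (N - 1) (S_mat N x \<omega> b) Qb \<sigma>b"
  shows "invertible_mat (KL_mat N x a b) \<and>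
      mat_inv (KL_mat N x a b) =
        - ((V_mat N x \<omega> b Qb \<otimes>\<^sub>K V_mat N x \<omega> a Qa) * LambdaL N \<sigma>a \<sigma>b *
           (mat_inv (V_mat N x \<omega> b Qb) \<otimes>\<^sub>K mat_inv (V_mat N x \<omega> a Qa)))
    \<and> invertible_mat (KB_mat N x a b) \<and>
      mat_inv (KB_mat N x a b) =
        - ((mat_inv (C_mat N x b) \<otimes>\<^sub>K mat_inv (C_mat N x a)) *
           (V_mat N x \<omega> b Qb \<otimes>\<^sub>K V_mat N x \<omega> a Qa) * LambdaB N \<sigma>a \<sigma>b *
           (mat_inv (V_mat N x \<omega> b Qb) \<otimes>\<^sub>K mat_inv (V_mat N x \<omega> a Qa)))
    \<and> invertible_mat (V_mat N x \<omega> a Qa) \<and>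
      mat_inv (V_mat N x \<omega> a Qa) =
        transpose_mat Qa * diag_powr (W_mat N \<omega>) (1/2) * diag_powr (C_mat N x a) (-1/2)
    \<and> invertible_mat (V_mat N x \<omega> b Qb) \<and>
      mat_inv (V_mat N x \<omega> b Qb) =
        transpose_mat Qb * diag_powr (W_mat N \<omega>) (1/2) * diag_powr (C_mat N x b) (-1/2)"

proof -
  note [simp del] = One_nat_def
  let ?n = "N - 1"
  have a: "\<forall>t\<in>{-1<..<1}. 0 < a t" and b: "\<forall>t\<in>{-1<..<1}. 0 < b t"
    using assms(5,6) by auto
  note N = assms(1) and rule = assms(2) and oda = assms(7) and odb = assms(8)
  define Va Vb Va' Vb' where "Va = V_mat N x \<omega> a Qa" and "Vb = V_mat N x \<omega> b Qb"
    and "Va' = mat_inv Va" and "Vb' = mat_inv Vb"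
  let ?Ua = "transpose_mat Qa * diag_powr (W_mat N \<omega>) (1/2) * diag_powr (C_mat N x a) (-1/2)"
  let ?Ub = "transpose_mat Qb * diag_powr (W_mat N \<omega>) (1/2) * diag_powr (C_mat N x b) (-1/2)"
  have Qa: "Qa \<in> carrier_mat ?n ?n" "transpose_mat Qa * Qa = 1\<^sub>m ?n"
    and Qb: "Qb \<in> carrier_mat ?n ?n" "transpose_mat Qb * Qb = 1\<^sub>m ?n"
    using oda odb unfolding orthogonal_diagonalisation_def by auto
  note Va = V_mat_inverse[OF N rule a Qa, folded Va_def]
  note Vb = V_mat_inverse[OF N rule b Qb, folded Vb_def]
  have U: "?Ua \<in> carrier_mat ?n ?n" "?Ub \<in> carrier_mat ?n ?n"
    using Qa Qb by (auto simp: diag_powr_def C_mat_def W_mat_def diag1_def mat_diag_def)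
  note inva = mat_inv_eqI[OF Va(1) U(1) Va(2)] and invb = mat_inv_eqI[OF Vb(1) U(2) Vb(2)]
  have V': "Va' \<in> carrier_mat ?n ?n" "Vb' \<in> carrier_mat ?n ?n"
    "Va * Va' = 1\<^sub>m ?n" "Vb * Vb' = 1\<^sub>m ?n"
    using U Va(2) Vb(2) unfolding Va'_def Vb'_def inva(2) invb(2) by auto
  let ?L = "Vb \<otimes>\<^sub>K Va" and ?L' = "Vb' \<otimes>\<^sub>K Va'"
  have L: "?L \<in> carrier_mat (?n * ?n) (?n * ?n)" "?L' \<in> carrier_mat (?n * ?n) (?n * ?n)"
    using Va(1) Vb(1) V' by auto
  have LL': "?L * ?L' = 1\<^sub>m (?n * ?n)"
    using kronecker_mult[OF Vb(1) Va(1) V'(2,1)] V'(3,4) by (simp add: kronecker_one)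
  \<comment> \<open>This order serves both operators: it is the relation on the right factor of
    \<open>K_L\<close>, and it closes the corresponding product for \<open>K_B\<close>.\<close>
  have L'L: "?L' * ?L = 1\<^sub>m (?n * ?n)"
    using mat_mult_left_right_inverse[OF L LL'] .
  have sa: "\<sigma>a (k + 1) < 0" and sb: "\<sigma>b (k + 1) < 0" if "k < ?n" for k
    using S_mat_eigenvalue_neg[OF N rule a oda that] S_mat_eigenvalue_neg[OF N rule b odb that] .
  have sk: "\<sigma>a (k mod ?n + 1) < 0" "\<sigma>b (k div ?n + 1) < 0" if "k < ?n * ?n" for k
    using sa sb div_mod_less_mult[OF that] by auto

  have KL: "KL_mat N x a b =
      ?L * (- mat_diag (?n * ?n) (\<lambda>k. 1 / \<sigma>a (k mod ?n + 1) + 1 / \<sigma>b (k div ?n + 1))) * ?L'"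
  proof -
    have "1\<^sub>m ?n \<otimes>\<^sub>K (C_mat N x a * D2_mat N x) =
        (Vb * 1\<^sub>m ?n * Vb') \<otimes>\<^sub>K (Va * diag1 ?n (\<lambda>k. 1 / \<sigma>a k) * Va')"
      using C_mat_mult_D2_mat[OF N rule a oda, folded Va_def, folded Va'_def] Vb(1) V'(4) by simp
    also have "\<dots> = ?L * mat_diag (?n * ?n) (\<lambda>k. 1 / \<sigma>a (k mod ?n + 1)) * ?L'"
      using Va(1) Vb(1) V'
      by (subst kronecker_mult3[of _ ?n]) (auto simp: diag1_def kronecker_mat_diag mat_diag_one[symmetric] simp del: mat_diag_one)
    finally have 1: "1\<^sub>m ?n \<otimes>\<^sub>K (C_mat N x a * D2_mat N x) = \<dots>" .
    have "(C_mat N x b * D2_mat N x) \<otimes>\<^sub>K 1\<^sub>m ?n =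
        (Vb * diag1 ?n (\<lambda>k. 1 / \<sigma>b k) * Vb') \<otimes>\<^sub>K (Va * 1\<^sub>m ?n * Va')"
      using C_mat_mult_D2_mat[OF N rule b odb, folded Vb_def, folded Vb'_def] Va(1) V'(3) by simp
    also have "\<dots> = ?L * mat_diag (?n * ?n) (\<lambda>k. 1 / \<sigma>b (k div ?n + 1)) * ?L'"
      using Va(1) Vb(1) V'
      by (subst kronecker_mult3[of _ ?n]) (auto simp: diag1_def kronecker_mat_diag mat_diag_one[symmetric] simp del: mat_diag_one)
    finally have 2: "(C_mat N x b * D2_mat N x) \<otimes>\<^sub>K 1\<^sub>m ?n = \<dots>" .
    show ?thesis
      unfolding KL_mat_def 1 2 minus_diff_mult_distrib_mat[OF L(1) mat_diag_dim mat_diag_dim L(2)]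
        mat_diag_minus_add ..
  qed
  have 1: "invertible_mat (KL_mat N x a b)" "mat_inv (KL_mat N x a b) = - (?L * LambdaL N \<sigma>a \<sigma>b * ?L')"
  proof -
    have nz: "\<forall>k<?n * ?n. (1 / \<sigma>a (k mod ?n + 1) + 1 / \<sigma>b (k div ?n + 1)) *
        (\<sigma>a (k mod ?n + 1) * \<sigma>b (k div ?n + 1) / (\<sigma>a (k mod ?n + 1) + \<sigma>b (k div ?n + 1))) = 1"
    proof (intro allI impI)
      fix k assume "k < ?n * ?n"
      note s = sk[OF this]
      \<comment> \<open>The signs enter twice: \<open>u * v\<close> must be nonzero to combine the
        fractions, and \<open>u + v\<close> must be nonzero to cancel against
        \<open>LambdaL\<close>.\<close>
      have "1 / u + 1 / v = (u + v) / (u * v)" if "u < 0" "v < 0" for u v :: real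
        using that by (simp add: field_simps)
      from this[OF s] show "(1 / \<sigma>a (k mod ?n + 1) + 1 / \<sigma>b (k div ?n + 1)) *
          (\<sigma>a (k mod ?n + 1) * \<sigma>b (k div ?n + 1) / (\<sigma>a (k mod ?n + 1) + \<sigma>b (k div ?n + 1))) = 1"
        using s add_neg_neg[OF s] by simp
    qed
    note inv_uminus_conjugate_diag[OF L(1,2,2,1) LL' L'L nz KL]
    then show "invertible_mat (KL_mat N x a b)"
      "mat_inv (KL_mat N x a b) = - (?L * LambdaL N \<sigma>a \<sigma>b * ?L')"
      unfolding LambdaL_def diag2_def .
  qed

  let ?Ci = "mat_inv (C_mat N x b) \<otimes>\<^sub>K mat_inv (C_mat N x a)" and ?C = "C_mat N x b \<otimes>\<^sub>K C_mat N x a"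
  have nz: "a (x (k + 1)) \<noteq> 0" "b (x (k + 1)) \<noteq> 0" if "k < ?n" for k
    using that a b lgl_rule_nodes(2)[OF N rule, of "k + 1"] by force+
  note Ca = C_mat_inverse[of N a x, OF nz(1)] and Cb = C_mat_inverse[of N b x, OF nz(2)]
  have C: "?C \<in> carrier_mat (?n * ?n) (?n * ?n)" "?Ci \<in> carrier_mat (?n * ?n) (?n * ?n)"
    using Ca Cb by auto
  have CC: "?C * ?Ci = 1\<^sub>m (?n * ?n)"
    using kronecker_mult[OF Cb(1) Ca(1) Cb(2) Ca(2)] Ca(3) Cb(3) by (simp add: kronecker_one)
  \<comment> \<open>\<open>C_b (x) C_a\<close> stays attached to the right factor, and
    \<open>?R'\<close> undoes the two parts in reverse order.\<close>
  let ?R = "?L' * ?C" and ?R' = "?Ci * ?L"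
  have R: "?R \<in> carrier_mat (?n * ?n) (?n * ?n)" "?R' \<in> carrier_mat (?n * ?n) (?n * ?n)"
    using L C by auto
  have "?R * ?R' = ?L' * ((?C * ?Ci) * ?L)"
    using L C by (simp add: assoc_mult_mat[of _ "?n * ?n" "?n * ?n" _ "?n * ?n" _ "?n * ?n"])
  then have RR': "?R * ?R' = 1\<^sub>m (?n * ?n)"
    unfolding CC using L L'L by simp
  have KB: "KB_mat N x a b =
      ?L * (- mat_diag (?n * ?n) (\<lambda>k. \<sigma>b (k div ?n + 1) + \<sigma>a (k mod ?n + 1))) * ?R"
  proof -
    have "B_mat N x \<otimes>\<^sub>K C_mat N x a =
        (Vb * diag1 ?n \<sigma>b * (Vb' * C_mat N x b)) \<otimes>\<^sub>K (Va * 1\<^sub>m ?n * (Va' * C_mat N x a))"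
      using B_mat_diagonalisation[OF N rule b odb, folded Vb_def, folded Vb'_def] Va(1) Vb(1) V' Ca Cb
      by (simp add: assoc_mult_mat[of _ ?n ?n _ ?n _ ?n, symmetric] diag1_def)
    also have "\<dots> = ?L * mat_diag (?n * ?n) (\<lambda>k. \<sigma>b (k div ?n + 1)) * ?R"
      using Va(1) Vb(1) V' Ca Cb
      by (subst kronecker_mult3[of _ ?n]) (auto simp: kronecker_mult[OF V'(2,1) Cb(1) Ca(1)]
          diag1_def kronecker_mat_diag mat_diag_one[symmetric] simp del: mat_diag_one)
    finally have 1: "B_mat N x \<otimes>\<^sub>K C_mat N x a = \<dots>" .
    have "C_mat N x b \<otimes>\<^sub>K B_mat N x =
        (Vb * 1\<^sub>m ?n * (Vb' * C_mat N x b)) \<otimes>\<^sub>K (Va * diag1 ?n \<sigma>a * (Va' * C_mat N x a))"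
      using B_mat_diagonalisation[OF N rule a oda, folded Va_def, folded Va'_def] Va(1) Vb(1) V' Ca Cb
      by (simp add: assoc_mult_mat[of _ ?n ?n _ ?n _ ?n, symmetric] diag1_def)
    also have "\<dots> = ?L * mat_diag (?n * ?n) (\<lambda>k. \<sigma>a (k mod ?n + 1)) * ?R"
      using Va(1) Vb(1) V' Ca Cb
      by (subst kronecker_mult3[of _ ?n]) (auto simp: kronecker_mult[OF V'(2,1) Cb(1) Ca(1)]
          diag1_def kronecker_mat_diag mat_diag_one[symmetric] simp del: mat_diag_one)
    finally have 2: "C_mat N x b \<otimes>\<^sub>K B_mat N x = \<dots>" .
    show ?thesis
      unfolding KB_mat_def 1 2 minus_diff_mult_distrib_mat[OF L(1) mat_diag_dim mat_diag_dim R(1)]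
        mat_diag_minus_add ..
  qed
  have 2: "invertible_mat (KB_mat N x a b)" "mat_inv (KB_mat N x a b) = - (?Ci * ?L * LambdaB N \<sigma>a \<sigma>b * ?L')"
  proof -
    have nz: "\<forall>k<?n * ?n. (\<sigma>b (k div ?n + 1) + \<sigma>a (k mod ?n + 1)) *
        (1 / (\<sigma>a (k mod ?n + 1) + \<sigma>b (k div ?n + 1))) = 1"
    proof (intro allI impI)
      fix k assume "k < ?n * ?n"
      from add_neg_neg[OF sk[OF this]]
      show "(\<sigma>b (k div ?n + 1) + \<sigma>a (k mod ?n + 1)) *
          (1 / (\<sigma>a (k mod ?n + 1) + \<sigma>b (k div ?n + 1))) = 1"
        by (simp add: add.commute)
    qed
    note inv_uminus_conjugate_diag[OF L(1) R(1) L(2) R(2) LL' RR' nz KB]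
    then show "invertible_mat (KB_mat N x a b)"
      "mat_inv (KB_mat N x a b) = - (?Ci * ?L * LambdaB N \<sigma>a \<sigma>b * ?L')"
      unfolding LambdaB_def diag2_def .
  qed
  show ?thesis
    using 1 2 inva invb unfolding Va'_def Vb'_def Va_def Vb_def by blast
qed

end
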